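(* The fragment $\mathcal{H}^{2c}_{3,\infty}$ is not reducible to $\mathcal{H}^{2c}_{3,2}$.
   Context: Clauses and fragments. - Clauses are function-free second-order Horn clauses: a head (at most one positive literal) and a finite body of negative literals. Each literal is a predicate variable of arity in $\mathbb{N}^*$ applied to term variables. - The body size $|C|$ is the number of body literals. - A clause is connected if its literals cannot be partitioned into two non-empty sets with disjoint variable sets. - $\mathcal{H}^{2c}$ is the set of connected clauses in which every term variable occurs in at least two distinct literals. - $\mathcal{F}_{a,b}$ denotes the clauses of $\mathcal{F}$ with all literal arities at most $a$ and body size at most $b$; $\infty$ means no bound. - Fragments are considered modulo variable renaming and contain only the most general clauses up to variable unification. SLD-resolution. - Substitutions map term variables to term variables and predicate variables to predicate variables of the same arity. - An SLD-resolution inference $C_1,C_2\vdash C$ is binary resolution without factoring: a body literal of one premise is unified by a most general unifier with the head of the other, and the resolvent consists of the remaining literals with the unifier applied. Reducibility. A fragment $\mathcal{F}$ is reducible to $\mathcal{F}_{\infty,b}$ if, for every $C\in\mathcal{F}$ with $b<|C|$, there exists $b'<|C|$ such that $C$ is the resolvent of an SLD-inference whose premises lie in $\mathcal{F}_{\infty,b'}$. *)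

theory Defs
  imports Main "HOL-Library.Multiset" "HOL-Library.Extended_Nat"
begin

type_synonym tvar = nat

text \<open>A predicate variable is a name together with its arity, so there are infinitely many
  predicate variables of every arity.\<close>

datatype pvar = PVar (pname: nat) (arity: nat)

datatype atom = Atom (pred: pvar) (args: "tvar list")

datatype literal = Pos (atom_of: atom) | Neg (atom_of: atom)

text \<open>Bodies are multisets, because resolution is without factoring: literals that become equal
  under the unifier are not merged.\<close>

datatype clause = Clause (head: "atom option") (body: "atom multiset")

definition wf_atom :: "atom \<Rightarrow> bool" where
  "wf_atom A \<longleftrightarrow> arity (pred A) > 0 \<and> length (args A) = arity (pred A)"

definition literals :: "clause \<Rightarrow> literal multiset" where
  "literals C = (case head C of None \<Rightarrow> {#} | Some H \<Rightarrow> {#Pos H#}) + image_mset Neg (body C)"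

definition body_size :: "clause \<Rightarrow> nat" where
  "body_size C = size (body C)"

definition tvars_lit :: "literal \<Rightarrow> tvar set" where
  "tvars_lit l = set (args (atom_of l))"

definition tvars :: "clause \<Rightarrow> tvar set" where
  "tvars C = (\<Union>l \<in> set_mset (literals C). tvars_lit l)"

definition pvars :: "clause \<Rightarrow> pvar set" where
  "pvars C = (\<lambda>l. pred (atom_of l)) ` set_mset (literals C)"

definition horn_clauses :: "clause set" where
  "horn_clauses = {C. \<forall>l \<in># literals C. wf_atom (atom_of l)}"

definition connected :: "clause \<Rightarrow> bool" where
  "connected C \<longleftrightarrow>
    \<not> (\<exists>A B. literals C = A + B \<and> A \<noteq> {#} \<and> B \<noteq> {#} \<and>
          (\<Union>l \<in> set_mset A. tvars_lit l) \<inter> (\<Union>l \<in> set_mset B. tvars_lit l) = {})"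

text \<open>A substitution is a pair of a map \<open>\<theta>\<close> on term variables and an arity-preserving map
  \<open>\<pi>\<close> on predicate variables.\<close>

definition arity_preserving :: "(pvar \<Rightarrow> pvar) \<Rightarrow> bool" where
  "arity_preserving \<pi> \<longleftrightarrow> (\<forall>P. arity (\<pi> P) = arity P)"

definition subst_atom :: "(tvar \<Rightarrow> tvar) \<Rightarrow> (pvar \<Rightarrow> pvar) \<Rightarrow> atom \<Rightarrow> atom" where
  "subst_atom \<theta> \<pi> A = Atom (\<pi> (pred A)) (map \<theta> (args A))"

definition subst_clause :: "(tvar \<Rightarrow> tvar) \<Rightarrow> (pvar \<Rightarrow> pvar) \<Rightarrow> clause \<Rightarrow> clause" where
  "subst_clause \<theta> \<pi> C =
    Clause (map_option (subst_atom \<theta> \<pi>) (head C)) (image_mset (subst_atom \<theta> \<pi>) (body C))"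

text \<open>Equality modulo variable renaming.\<close>

definition variant :: "clause \<Rightarrow> clause \<Rightarrow> bool" where
  "variant C D \<longleftrightarrow>
    (\<exists>\<theta> \<pi>. bij \<theta> \<and> bij \<pi> \<and> arity_preserving \<pi> \<and> D = subst_clause \<theta> \<pi> C)"

definition unifier :: "(tvar \<Rightarrow> tvar) \<Rightarrow> (pvar \<Rightarrow> pvar) \<Rightarrow> atom \<Rightarrow> atom \<Rightarrow> bool" where
  "unifier \<theta> \<pi> A B \<longleftrightarrow> arity_preserving \<pi> \<and> subst_atom \<theta> \<pi> A = subst_atom \<theta> \<pi> B"

definition mgu :: "(tvar \<Rightarrow> tvar) \<Rightarrow> (pvar \<Rightarrow> pvar) \<Rightarrow> atom \<Rightarrow> atom \<Rightarrow> bool" where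
  "mgu \<theta> \<pi> A B \<longleftrightarrow> unifier \<theta> \<pi> A B \<and>
    (\<forall>\<theta>' \<pi>'. unifier \<theta>' \<pi>' A B \<longrightarrow>
      (\<exists>\<delta> \<epsilon>. arity_preserving \<epsilon> \<and> \<theta>' = \<delta> \<circ> \<theta> \<and> \<pi>' = \<epsilon> \<circ> \<pi>))"

text \<open>The clauses of \<open>F\<close> that are proper instances of no clause of \<open>F\<close>. Sets of clauses are
  closed under renaming rather than quotiented by it.\<close>

definition most_general :: "clause set \<Rightarrow> clause set" where
  "most_general F = {C \<in> F. \<forall>D \<in> F. \<forall>\<theta> \<pi>.
     arity_preserving \<pi> \<and> C = subst_clause \<theta> \<pi> D \<longrightarrow> variant D C}"

definition H2c :: "clause set" where
  "H2c = most_general {C \<in> horn_clauses. connected C \<and>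
     (\<forall>x \<in> tvars C. \<exists>l \<in># literals C. \<exists>l' \<in># literals C.
        l \<noteq> l' \<and> x \<in> tvars_lit l \<and> x \<in> tvars_lit l')}"

text \<open>\<open>fragment F a b\<close> is \<open>F\<^bsub>a,b\<^esub>\<close>. Substitutions change neither arities nor body sizes, so
  taking most general clauses before or after imposing the bounds gives the same set.\<close>

definition fragment :: "clause set \<Rightarrow> enat \<Rightarrow> enat \<Rightarrow> clause set" where
  "fragment F a b = {C \<in> F.
     (\<forall>l \<in># literals C. enat (arity (pred (atom_of l))) \<le> a) \<and> enat (body_size C) \<le> b}"

lemma fragment_fragment:
  "fragment (fragment F a b) a' b' = fragment F (min a a') (min b b')"
  by (auto simp: fragment_def)

definition resolvent :: "clause \<Rightarrow> clause \<Rightarrow> clause \<Rightarrow> bool" where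
  "resolvent C\<^sub>1 C\<^sub>2 C \<longleftrightarrow>
    (\<exists>L H \<theta> \<pi>. L \<in># body C\<^sub>1 \<and> head C\<^sub>2 = Some H \<and> mgu \<theta> \<pi> L H \<and>
       C = subst_clause \<theta> \<pi> (Clause (head C\<^sub>1) ((body C\<^sub>1 - {#L#}) + body C\<^sub>2)))"

text \<open>The inference \<open>C\<^sub>1, C\<^sub>2 \<turnstile> C\<close>, modulo variable renaming; premises are renamed apart.\<close>

definition sld :: "clause \<Rightarrow> clause \<Rightarrow> clause \<Rightarrow> bool" where
  "sld C\<^sub>1 C\<^sub>2 C \<longleftrightarrow>
    (\<exists>D\<^sub>1 D\<^sub>2 D. variant C\<^sub>1 D\<^sub>1 \<and> variant C\<^sub>2 D\<^sub>2 \<and>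
       tvars D\<^sub>1 \<inter> tvars D\<^sub>2 = {} \<and> pvars D\<^sub>1 \<inter> pvars D\<^sub>2 = {} \<and>
       (resolvent D\<^sub>1 D\<^sub>2 D \<or> resolvent D\<^sub>2 D\<^sub>1 D) \<and> variant D C)"

text \<open>\<open>reducible F b\<close> states that \<open>F\<close> is reducible to \<open>F\<^bsub>\<infinity>,b\<^esub> = fragment F \<infinity> b\<close>.
  For \<open>F = H\<^bsub>a,\<infinity>\<^esub>\<close> the target is \<open>H\<^bsub>a,b\<^esub>\<close> by \<open>fragment_fragment\<close>.\<close>

definition reducible :: "clause set \<Rightarrow> nat \<Rightarrow> bool" where
  "reducible F b \<longleftrightarrow>
    (\<forall>C \<in> F. b < body_size C \<longrightarrow>
      (\<exists>b' < body_size C. \<exists>C\<^sub>1 \<in> fragment F \<infinity> (enat b'). \<exists>C\<^sub>2 \<in> fragment F \<infinity> (enat b').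
         sld C\<^sub>1 C\<^sub>2 C))"

end

theory Submission
  imports Defs "HOL-Combinatorics.Transposition"
begin

text \<open>Read a clause in which every variable occurs exactly twice as a graph: literals are
  vertices and variables are edges. The complete graph on four vertices gives a clause of arity 3
  and body size 3. Counting body literals, an inference deriving it from smaller clauses would take
  two of its literals from each premise, so four of its variables would occur on both sides. However,
  a most general unifier identifies variables of the two premises only if they occur in the
  resolved literals, which leaves room for at most three shared variables.\<close>

section \<open>Extending injective substitutions to renamings\<close>

text \<open>On a finite set the values can be corrected one at a time by transpositions. The map
  \<open>h\<close> is an invariant of the extension: arity for predicate variables, a constant for
  term variables.\<close>

lemma finite_inj_extends_to_bij:
  assumes "finite A" "inj_on f A" "\<And>x. x \<in> A \<Longrightarrow> h (f x) = h x"
  shows "\<exists>g. bij g \<and> (\<forall>x. h (g x) = h x) \<and> (\<forall>x\<in>A. g x = f x)"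
  using assms
proof (induction A rule: finite_induct)
  case empty
  show ?case by (intro exI[of _ id] conjI bij_id) simp_all
next
  case (insert a A)
  then obtain g where g: "bij g" "\<And>x. h (g x) = h x" "\<And>x. x \<in> A \<Longrightarrow> g x = f x"
    by (auto simp: inj_on_def)
  \<comment> \<open>The swapped values \<open>g a\<close> and \<open>f a\<close> both have invariant
    \<open>h a\<close>, so \<open>h\<close> is preserved. Neither is a value of \<open>f\<close> on
    \<open>A\<close>, so the values fixed earlier stay.\<close>
  let ?g = "transpose (g a) (f a) \<circ> g"
  have "bij ?g"
    using g(1) by (intro bij_comp) auto
  moreover have "h (?g x) = h x" for x
    unfolding comp_apply transpose_def using g(2) insert.prems(2)[of a] by (metis insertI1)
  moreover have "?g x = f x" if "x \<in> insert a A" for x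
  proof (cases "x = a")
    case False
    then have x: "x \<in> A" using that by simp
    have "g x \<noteq> g a" using False g(1) by (meson bij_is_inj injD)
    moreover have "g x \<noteq> f a"
      using g(3)[OF x] x insert.prems(1) insert.hyps(2) by (auto simp: inj_on_def)
    ultimately show ?thesis using g(3)[OF x] by simp
  qed simp
  ultimately show ?case by blast
qed

lemma subst_clause_cong:
  assumes "\<And>x. x \<in> tvars C \<Longrightarrow> \<theta> x = \<theta>' x" "\<And>P. P \<in> pvars C \<Longrightarrow> \<pi> P = \<pi>' P"
  shows "subst_clause \<theta> \<pi> C = subst_clause \<theta>' \<pi>' C"
proof -
  have *: "subst_atom \<theta> \<pi> A = subst_atom \<theta>' \<pi>' A"
    if "l \<in># literals C" "atom_of l = A" for l A
    using that assms unfolding subst_atom_def tvars_def tvars_lit_def pvars_def by force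
  have "map_option (subst_atom \<theta> \<pi>) (head C) = map_option (subst_atom \<theta>' \<pi>') (head C)"
    using *[of "Pos (the (head C))"] by (cases "head C") (auto simp: literals_def)
  moreover have "image_mset (subst_atom \<theta> \<pi>) (body C) = image_mset (subst_atom \<theta>' \<pi>') (body C)"
    using *[of "Neg A" A for A] by (intro image_mset_cong) (auto simp: literals_def)
  ultimately show ?thesis by (simp add: subst_clause_def)
qed

text \<open>Renamings must be bijections on all variables, but a substitution acts on a clause only
  through its finitely many variables, so injectivity there suffices.\<close>

lemma variant_subst_clause_if_inj_on:
  assumes "arity_preserving \<pi>" "inj_on \<theta> (tvars D)" "inj_on \<pi> (pvars D)"
  shows "variant D (subst_clause \<theta> \<pi> D)"
proof -
  have "finite (tvars D)" "finite (pvars D)"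
    by (auto simp: tvars_def pvars_def tvars_lit_def)
  then obtain \<theta>' \<pi>' where "bij \<theta>'" "\<And>x. x \<in> tvars D \<Longrightarrow> \<theta>' x = \<theta> x"
    and "bij \<pi>'" "\<And>P. arity (\<pi>' P) = arity P" "\<And>P. P \<in> pvars D \<Longrightarrow> \<pi>' P = \<pi> P"
    using finite_inj_extends_to_bij[of "tvars D" \<theta> "\<lambda>_. ()"]
      finite_inj_extends_to_bij[of "pvars D" \<pi> arity] assms
    by (auto simp: arity_preserving_def)
  then show ?thesis
    unfolding variant_def arity_preserving_def using subst_clause_cong[of D \<theta> \<theta>' \<pi> \<pi>'] by metis
qed

section \<open>Variables shared by the two sides of an inference\<close>

text \<open>Unification does not constrain a variable outside both atoms. Some unifier therefore
  keeps it apart from every other variable, and a most general one, through which that unifier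
  factors, must do so too.\<close>

lemma mgu_identifies_only_args:
  assumes "mgu \<theta> \<pi> A B" "\<theta> x = \<theta> y" "x \<noteq> y"
  shows "x \<in> set (args A) \<union> set (args B)"
proof (rule ccontr)
  assume x: "x \<notin> set (args A) \<union> set (args B)"
  \<comment> \<open>This map separates \<open>x\<close> from everything else and sends all arguments
    of both atoms to 0, so it unifies them once their lengths agree and \<open>\<pi>\<close> matches
    their predicates.\<close>
  define \<theta>' :: "tvar \<Rightarrow> tvar" where "\<theta>' = (\<lambda>z. if z = x then 1 else 0)"
  have u: "unifier \<theta> \<pi> A B" using assms(1) by (simp add: mgu_def)
  then have "length (args A) = length (args B)"
    unfolding unifier_def subst_atom_def by (metis atom.inject length_map)
  moreover have "map \<theta>' (args A) = replicate (length (args A)) 0"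
    "map \<theta>' (args B) = replicate (length (args B)) 0"
    using x by (auto simp: \<theta>'_def map_replicate_const[symmetric] intro!: map_cong)
  ultimately have "unifier \<theta>' \<pi> A B"
    using u by (auto simp: unifier_def subst_atom_def)
  then obtain \<delta> where "\<theta>' = \<delta> \<circ> \<theta>"
    using assms(1) unfolding mgu_def by blast
  then have "\<theta>' x = \<theta>' y" using assms(2) by simp
  then show False using assms(3) by (simp add: \<theta>'_def)
qed

definition tvars_mset :: "literal multiset \<Rightarrow> tvar set" where
  "tvars_mset M = (\<Union>l \<in> set_mset M. tvars_lit l)"

lemma tvars_lit_subst:
  "tvars_lit (Pos (subst_atom \<theta> \<pi> A)) = \<theta> ` tvars_lit (Pos A)"
  "tvars_lit (Neg (subst_atom \<theta> \<pi> A)) = \<theta> ` tvars_lit (Neg A)"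
  by (auto simp: tvars_lit_def subst_atom_def)

text \<open>Split the resolvent by the premise its literals come from. A shared variable comes from
  a variable of each premise, and these differ since the premises are renamed apart. So it is the
  image of one of the at most \<open>n\<close> arguments of the resolved literal.\<close>

lemma resolvent_shared_tvars:
  assumes "resolvent D\<^sub>1 D\<^sub>2 D" "tvars D\<^sub>1 \<inter> tvars D\<^sub>2 = {}"
    and "\<forall>l \<in># literals D\<^sub>1. length (args (atom_of l)) \<le> n"
  shows "\<exists>M N. body D = M + N \<and> size M + 1 = body_size D\<^sub>1 \<and> size N = body_size D\<^sub>2 \<and>
    card (tvars_mset (literals (Clause (head D) M)) \<inter> tvars_mset (image_mset Neg N)) \<le> n"
proof -
  obtain L H \<theta> \<pi> where L: "L \<in># body D\<^sub>1" and H: "head D\<^sub>2 = Some H" and m: "mgu \<theta> \<pi> L H"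
    and D: "D = subst_clause \<theta> \<pi> (Clause (head D\<^sub>1) ((body D\<^sub>1 - {#L#}) + body D\<^sub>2))"
    using assms(1) unfolding resolvent_def by blast
  let ?s = "image_mset (subst_atom \<theta> \<pi>)"
  let ?M = "?s (body D\<^sub>1 - {#L#})" and ?N = "?s (body D\<^sub>2)"
  let ?S = "tvars_mset (literals (Clause (head D) ?M)) \<inter> tvars_mset (image_mset Neg ?N)"
  have "tvars_mset (literals (Clause (head D) ?M)) \<subseteq> \<theta> ` tvars D\<^sub>1"
    by (cases "head D\<^sub>1")
      (fastforce simp: D tvars_mset_def tvars_def literals_def subst_clause_def tvars_lit_subst
        dest: in_diffD)+
  moreover have "tvars_mset (image_mset Neg ?N) \<subseteq> \<theta> ` tvars D\<^sub>2"
    by (fastforce simp: tvars_mset_def tvars_def literals_def tvars_lit_subst)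
  \<comment> \<open>A variable of \<open>D\<^sub>1\<close> is thus never an argument of
    \<open>H\<close>, so an identified one must be an argument of \<open>L\<close>.\<close>
  moreover have "set (args H) \<subseteq> tvars D\<^sub>2"
    using H by (auto simp: tvars_def literals_def tvars_lit_def)
  ultimately have "?S \<subseteq> \<theta> ` set (args L)"
    using mgu_identifies_only_args[OF m] assms(2) by blast
  then have "card ?S \<le> card (set (args L))"
    by (meson List.finite_set card_image_le card_mono finite_imageI le_trans)
  also have "\<dots> \<le> length (args L)" by (rule card_length)
  also have "\<dots> \<le> n" using L assms(3) by (force simp: literals_def)
  finally have "card ?S \<le> n" .
  moreover have "body D = ?M + ?N" by (simp add: D subst_clause_def)
  moreover have "size ?M + 1 = body_size D\<^sub>1" "size ?N = body_size D\<^sub>2"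
    using L by (auto simp: body_size_def size_Diff_singleton dest: multi_member_split)
  ultimately show ?thesis by blast
qed

lemma literals_subst_clause:
  "literals (subst_clause \<theta> \<pi> C) =
    image_mset (\<lambda>l. case l of Pos A \<Rightarrow> Pos (subst_atom \<theta> \<pi> A) | Neg A \<Rightarrow> Neg (subst_atom \<theta> \<pi> A))
      (literals C)"
  by (cases "head C") (auto simp: literals_def subst_clause_def image_mset.compositionality comp_def)

lemma tvars_mset_subst:
  "tvars_mset (literals (subst_clause \<theta> \<pi> C)) = \<theta> ` tvars_mset (literals C)"
proof -
  have "tvars_lit (case l of Pos A \<Rightarrow> Pos (subst_atom \<theta> \<pi> A) | Neg A \<Rightarrow> Neg (subst_atom \<theta> \<pi> A)) =
      \<theta> ` tvars_lit l" for l
    by (cases l) (simp_all add: tvars_lit_subst)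
  then show ?thesis
    by (simp add: literals_subst_clause tvars_mset_def image_UN)
qed

lemma variant_body_size:
  assumes "variant C D"
  shows "body_size D = body_size C"
  using assms by (auto simp: variant_def subst_clause_def body_size_def)

text \<open>The bound passes through the variants: renamings preserve argument lengths and body
  sizes, and a bijection preserves the number of shared variables. The disjunction records which
  premise supplies the resolved body literal.\<close>

lemma sld_shared_tvars:
  assumes "sld C\<^sub>1 C\<^sub>2 C"
    and n: "\<forall>l \<in># literals C\<^sub>1 + literals C\<^sub>2. length (args (atom_of l)) \<le> n"
  shows "\<exists>M N. body C = M + N \<and>
    (size M + 1 = body_size C\<^sub>1 \<and> size N = body_size C\<^sub>2 \<or>
     size M + 1 = body_size C\<^sub>2 \<and> size N = body_size C\<^sub>1) \<and>
    card (tvars_mset (literals (Clause (head C) M)) \<inter> tvars_mset (image_mset Neg N)) \<le> n"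
proof -
  obtain D\<^sub>1 D\<^sub>2 D where v: "variant C\<^sub>1 D\<^sub>1" "variant C\<^sub>2 D\<^sub>2"
    and disj: "tvars D\<^sub>1 \<inter> tvars D\<^sub>2 = {}"
    and r: "resolvent D\<^sub>1 D\<^sub>2 D \<or> resolvent D\<^sub>2 D\<^sub>1 D" and vC: "variant D C"
    using assms(1) unfolding sld_def by blast
  have "\<forall>l \<in># literals D\<^sub>1. length (args (atom_of l)) \<le> n"
    "\<forall>l \<in># literals D\<^sub>2. length (args (atom_of l)) \<le> n"
    using v n by (force simp: variant_def literals_subst_clause subst_atom_def
        split: literal.splits)+
  then obtain M N where MN: "body D = M + N"
    "size M + 1 = body_size C\<^sub>1 \<and> size N = body_size C\<^sub>2 \<or>
     size M + 1 = body_size C\<^sub>2 \<and> size N = body_size C\<^sub>1"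
    "card (tvars_mset (literals (Clause (head D) M)) \<inter> tvars_mset (image_mset Neg N)) \<le> n"
    using r disj resolvent_shared_tvars[of D\<^sub>1 D\<^sub>2 D n] resolvent_shared_tvars[of D\<^sub>2 D\<^sub>1 D n]
      variant_body_size[OF v(1)] variant_body_size[OF v(2)]
    by (metis inf_commute)
  obtain \<theta> \<pi> where b: "bij \<theta>" and C: "C = subst_clause \<theta> \<pi> D"
    using vC unfolding variant_def by blast
  let ?s = "image_mset (subst_atom \<theta> \<pi>)"
  have "tvars_mset (literals (Clause (head C) (?s M))) =
      \<theta> ` tvars_mset (literals (Clause (head D) M))"
    using tvars_mset_subst[of \<theta> \<pi> "Clause (head D) M"] by (simp add: C subst_clause_def)
  moreover have "tvars_mset (image_mset Neg (?s N)) = \<theta> ` tvars_mset (image_mset Neg N)"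
    by (auto simp: tvars_mset_def tvars_lit_subst)
  ultimately have "card (tvars_mset (literals (Clause (head C) (?s M))) \<inter>
      tvars_mset (image_mset Neg (?s N))) \<le> n"
    using MN(3) b by (metis bij_is_inj image_Int card_image inj_on_subset subset_UNIV)
  moreover have "body C = ?s M + ?s N" using MN(1) by (simp add: C subst_clause_def)
  ultimately show ?thesis using MN(2) by (metis size_image_mset)
qed

section \<open>The clause of the complete graph on four vertices\<close>

text \<open>The variables 1 to 6 are the edges, and the head is one of the four vertices. The
  predicate variables are pairwise distinct, since otherwise a clause with distinct ones would be
  strictly more general.\<close>

definition K4 :: clause where
  "K4 = Clause (Some (Atom (PVar 0 3) [1, 2, 3]))
    {#Atom (PVar 1 3) [1, 4, 5], Atom (PVar 2 3) [2, 4, 6], Atom (PVar 3 3) [3, 5, 6]#}"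

lemma literals_K4:
  "literals K4 = {#Pos (Atom (PVar 0 3) [1, 2, 3]), Neg (Atom (PVar 1 3) [1, 4, 5]),
    Neg (Atom (PVar 2 3) [2, 4, 6]), Neg (Atom (PVar 3 3) [3, 5, 6])#}"
  by (simp add: literals_def K4_def)

text \<open>Any two literals of the clause share a variable.\<close>

lemma connected_K4: "connected K4"
  unfolding connected_def
proof safe
  fix A B
  assume AB: "literals K4 = A + B" "A \<noteq> {#}" "B \<noteq> {#}"
    "(\<Union>l \<in> set_mset A. tvars_lit l) \<inter> (\<Union>l \<in> set_mset B. tvars_lit l) = {}"
  obtain a b where ab: "a \<in># A" "b \<in># B" using AB(2,3) by blast
  then have "a \<in># literals K4" "b \<in># literals K4" using AB(1) by auto
  then have "tvars_lit a \<inter> tvars_lit b \<noteq> {}"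
    by (auto simp: literals_K4 tvars_lit_def)
  then show False using AB(4) ab by blast
qed

text \<open>This is what makes \<open>K4\<close> most general: a preimage with more variables would
  have to split an edge, leaving a variable in only one literal.\<close>

lemma instance_K4_variant:
  assumes D2: "\<forall>x \<in> tvars D. \<exists>l \<in># literals D. \<exists>l' \<in># literals D.
      l \<noteq> l' \<and> x \<in> tvars_lit l \<and> x \<in> tvars_lit l'"
    and \<pi>: "arity_preserving \<pi>" and K: "K4 = subst_clause \<theta> \<pi> D"
  shows "variant D K4"
proof -
  let ?s = "subst_atom \<theta> \<pi>"
  obtain H where H: "head D = Some H" "?s H = Atom (PVar 0 3) [1, 2, 3]"
    using K by (cases "head D") (auto simp: K4_def subst_clause_def)
  have "image_mset ?s (body D) =
    {#Atom (PVar 1 3) [1, 4, 5], Atom (PVar 2 3) [2, 4, 6], Atom (PVar 3 3) [3, 5, 6]#}"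
    using K by (simp add: K4_def subst_clause_def)
  then obtain X Y Z where B: "body D = {#X, Y, Z#}"
    and s: "?s X = Atom (PVar 1 3) [1, 4, 5]" "?s Y = Atom (PVar 2 3) [2, 4, 6]"
      "?s Z = Atom (PVar 3 3) [3, 5, 6]"
    by (auto dest!: msed_map_invR)
  have lits: "set_mset (literals D) = {Pos H, Neg X, Neg Y, Neg Z}"
    by (auto simp: literals_def H B)
  obtain a1 a2 a3 where a: "args H = [a1, a2, a3]" "\<theta> a1 = 1" "\<theta> a2 = 2" "\<theta> a3 = 3"
    using H(2) by (auto simp: subst_atom_def map_eq_Cons_conv)
  obtain b1 b4 b5 where b: "args X = [b1, b4, b5]" "\<theta> b1 = 1" "\<theta> b4 = 4" "\<theta> b5 = 5"
    using s(1) by (auto simp: subst_atom_def map_eq_Cons_conv)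
  obtain c2 c4 c6 where c: "args Y = [c2, c4, c6]" "\<theta> c2 = 2" "\<theta> c4 = 4" "\<theta> c6 = 6"
    using s(2) by (auto simp: subst_atom_def map_eq_Cons_conv)
  obtain d3 d5 d6 where d: "args Z = [d3, d5, d6]" "\<theta> d3 = 3" "\<theta> d5 = 5" "\<theta> d6 = 6"
    using s(3) by (auto simp: subst_atom_def map_eq_Cons_conv)
  have tv: "tvars D = {a1, a2, a3, b1, b4, b5, c2, c4, c6, d3, d5, d6}"
    by (auto simp: tvars_def lits tvars_lit_def a(1) b(1) c(1) d(1))
  \<comment> \<open>Each variable of the instance labels two positions only, and each variable of \<open>D\<close> needs two.\<close>
  have two: "x \<in> set (args H) \<and> (x \<in> set (args X) \<or> x \<in> set (args Y) \<or> x \<in> set (args Z)) \<or>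
      x \<in> set (args X) \<and> (x \<in> set (args Y) \<or> x \<in> set (args Z)) \<or>
      x \<in> set (args Y) \<and> x \<in> set (args Z)" if "x \<in> tvars D" for x
    using D2[rule_format, OF that] unfolding lits tvars_lit_def by auto
  note \<theta> = a(2-4) b(2-4) c(2-4) d(2-4)
  have \<theta>_neq: "x \<noteq> y" if "\<theta> x \<noteq> \<theta> y" for x y
    using that by blast
  \<comment> \<open>The variable \<open>a1\<close> needs a second literal, and \<open>b1\<close> is
    the only other argument that \<open>\<theta>\<close> maps to 1. The other five edges are treated
    alike, which leaves six variables with distinct images.\<close>
  have "a1 = b1"
    using two[of a1] \<theta>_neq[of a1] unfolding tv a(1) b(1) c(1) d(1) by (simp add: \<theta>)
  moreover have "a2 = c2"
    using two[of a2] \<theta>_neq[of a2] unfolding tv a(1) b(1) c(1) d(1) by (simp add: \<theta>)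
  moreover have "a3 = d3"
    using two[of a3] \<theta>_neq[of a3] unfolding tv a(1) b(1) c(1) d(1) by (simp add: \<theta>)
  moreover have "b4 = c4"
    using two[of b4] \<theta>_neq[of b4] unfolding tv a(1) b(1) c(1) d(1) by (simp add: \<theta>)
  moreover have "b5 = d5"
    using two[of b5] \<theta>_neq[of b5] unfolding tv a(1) b(1) c(1) d(1) by (simp add: \<theta>)
  moreover have "c6 = d6"
    using two[of c6] \<theta>_neq[of c6] unfolding tv a(1) b(1) c(1) d(1) by (simp add: \<theta>)
  ultimately have "inj_on \<theta> (tvars D)"
    unfolding tv using a b c d by (auto simp: inj_on_def)
  moreover have "pvars D = {pred H, pred X, pred Y, pred Z}"
    by (auto simp: pvars_def lits)
  then have "inj_on \<pi> (pvars D)"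
    using H(2) s by (auto simp: inj_on_def subst_atom_def)
  ultimately show ?thesis
    unfolding K using \<pi> by (intro variant_subst_clause_if_inj_on)
qed

lemma K4_in_H2c: "K4 \<in> H2c"
proof -
  have "K4 \<in> horn_clauses"
    by (simp add: horn_clauses_def literals_K4 wf_atom_def)
  moreover have "\<forall>x \<in> tvars K4. \<exists>l \<in># literals K4. \<exists>l' \<in># literals K4.
      l \<noteq> l' \<and> x \<in> tvars_lit l \<and> x \<in> tvars_lit l'"
    by (auto simp: tvars_def literals_K4 tvars_lit_def)
  ultimately show ?thesis
    unfolding H2c_def most_general_def using connected_K4 instance_K4_variant by blast
qed

text \<open>The head and one body literal face the other two. Of the six edges, one lies inside each
  pair of vertices, and the remaining four cross.\<close>

lemma K4_split_shared_tvars: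
  assumes "body K4 = M + N" "size M = 1"
  shows "card (tvars_mset (literals (Clause (head K4) M)) \<inter> tvars_mset (image_mset Neg N)) = 4"
proof -
  obtain A where M: "M = {#A#}" using assms(2) by (metis size_1_singleton_mset)
  have N: "N = body K4 - {#A#}" using assms(1) M by simp
  have "A \<in># body K4" using assms(1) M by simp
  then consider "A = Atom (PVar 1 3) [1, 4, 5]" | "A = Atom (PVar 2 3) [2, 4, 6]"
    | "A = Atom (PVar 3 3) [3, 5, 6]"
    by (auto simp: K4_def)
  then show ?thesis
    by cases (simp_all add: M N K4_def literals_def tvars_mset_def tvars_lit_def)
qed

theorem mainTheorem9: "\<not> reducible (fragment H2c 3 \<infinity>) 2"
proof
  assume red: "reducible (fragment H2c 3 \<infinity>) 2"
  have size: "body_size K4 = 3" by (simp add: body_size_def K4_def)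
  have "K4 \<in> fragment H2c 3 \<infinity>"
    using K4_in_H2c by (auto simp: fragment_def literals_K4 numeral_eq_enat)
  then obtain b' C\<^sub>1 C\<^sub>2 where b': "b' < 3" and sld: "sld C\<^sub>1 C\<^sub>2 K4"
    and C: "C\<^sub>1 \<in> fragment (fragment H2c 3 \<infinity>) \<infinity> (enat b')"
      "C\<^sub>2 \<in> fragment (fragment H2c 3 \<infinity>) \<infinity> (enat b')"
    using red size unfolding reducible_def by fastforce
  have le: "body_size C\<^sub>1 \<le> 2" "body_size C\<^sub>2 \<le> 2"
    using C b' by (auto simp: fragment_def)
  \<comment> \<open>The fragment bounds arities, and well-formedness turns this into a bound on
    argument lists.\<close>
  have "\<forall>l \<in># literals C\<^sub>1 + literals C\<^sub>2. length (args (atom_of l)) \<le> 3"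
    using C by (auto simp: fragment_def H2c_def most_general_def horn_clauses_def wf_atom_def
        numeral_eq_enat)
  from sld_shared_tvars[OF sld this] obtain M N where MN: "body K4 = M + N"
    "size M + 1 = body_size C\<^sub>1 \<and> size N = body_size C\<^sub>2 \<or>
     size M + 1 = body_size C\<^sub>2 \<and> size N = body_size C\<^sub>1"
    "card (tvars_mset (literals (Clause (head K4) M)) \<inter> tvars_mset (image_mset Neg N)) \<le> 3"
    by blast
  have "size M + size N = 3" using MN(1) size by (metis body_size_def size_union)
  \<comment> \<open>One premise bounds \<open>size M + 1\<close> by 2, the other bounds
    \<open>size N\<close> by 2; with total size 3 only the split into 1 and 2 remains.\<close>
  then have "size M = 1" using MN(2) le by linarith
  then show False using K4_split_shared_tvars[OF MN(1)] MN(3) by simp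
qed

end
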